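(* Let $\mathcal{V}=(V_1,\ldots,V_n)$ be a list of linear subspaces of $\mathbb{R}^\ell$ and let $\vec{p}\in\mathbb{R}^n$ be in the convex hull of all $\mathcal{V}$-admissible vectors. Then there exists an invertible linear map $M:\mathbb{R}^\ell\to\mathbb{R}^\ell$ such that for every unit vector $\vec{w}\in\mathbb{R}^\ell$, $$\sum_{i=1}^n p_i\,\|\mathrm{Proj}_{M(V_i)}(\vec{w})\|^2\leq 2,$$ where $\mathrm{Proj}_{M(V_i)}(\vec{w})$ is the orthogonal projection of $\vec{w}$ onto $M(V_i)$.
   Context: A set $H\subseteq[n]$ is $\mathcal{V}$-admissible if $\dim(\sum_{i\in H}V_i)=\sum_{i\in H}\dim(V_i)$. A $\mathcal{V}$-admissible vector is the indicator vector $\vec{1}_H\in\{0,1\}^n$ of a $\mathcal{V}$-admissible set $H$. *)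

theory Defs
  imports "HOL-Analysis.Analysis"
begin

text \<open>The left-hand sum is the Minkowski sum of the sets \<open>V i\<close> from \<open>HOL-Library.Set_Algebras\<close>;
  for empty \<open>H\<close> it is \<open>{0}\<close>.\<close>

definition admissible_set :: "('n \<Rightarrow> 'a::euclidean_space set) \<Rightarrow> 'n set \<Rightarrow> bool" where
  "admissible_set V H \<longleftrightarrow> dim (\<Sum>i\<in>H. V i) = (\<Sum>i\<in>H. dim (V i))"

definition indicator_vec :: "'n::finite set \<Rightarrow> real ^ 'n" where
  "indicator_vec H = (\<chi> i. indicator H i)"

definition admissible_vectors :: "('n::finite \<Rightarrow> 'a::euclidean_space set) \<Rightarrow> (real ^ 'n) set" where
  "admissible_vectors V = {indicator_vec H | H. admissible_set V H}"

definition orth_proj :: "'a::euclidean_space set \<Rightarrow> 'a \<Rightarrow> 'a" where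
  "orth_proj S w = (THE y. y \<in> S \<and> (\<forall>v\<in>S. orthogonal (w - y) v))"

lemma orth_proj_ex1:
  fixes S :: "'a::euclidean_space set"
  assumes "subspace S"
  shows "\<exists>!y. y \<in> S \<and> (\<forall>v\<in>S. orthogonal (w - y) v)"
proof -
  have sp: "span S = S"
    using assms by (simp add: span_eq_iff)
  obtain y z where y: "y \<in> S" and z: "\<And>v. v \<in> S \<Longrightarrow> orthogonal z v" and w: "w = y + z"
    using orthogonal_subspace_decomp_exists[of S w] unfolding sp by blast
  show ?thesis
  proof (rule ex1I[of _ y])
    show "y \<in> S \<and> (\<forall>v\<in>S. orthogonal (w - y) v)"
      using y z w by simp
  next
    fix x assume x: "x \<in> S \<and> (\<forall>v\<in>S. orthogonal (w - x) v)"
    have d: "x - y \<in> S"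
      using assms x y by (simp add: subspace_diff)
    have "(w - x) \<bullet> (x - y) = 0" "(w - y) \<bullet> (x - y) = 0"
      using x z w d by (auto simp: orthogonal_def)
    then have "(x - y) \<bullet> (x - y) = 0"
      by (simp add: inner_diff_left)
    then show "x = y" by simp
  qed
qed

lemma orth_proj_in:
  assumes "subspace S"
  shows "orth_proj S w \<in> S"
  using theI'[OF orth_proj_ex1[OF assms, of w]] by (simp add: orth_proj_def)

lemma orth_proj_orthogonal:
  assumes "subspace S" and "v \<in> S"
  shows "orthogonal (w - orth_proj S w) v"
  using theI'[OF orth_proj_ex1[OF assms(1), of w]] assms(2) by (simp add: orth_proj_def)

end

theory Submission
  imports Defs
begin

text \<open>For an invertible contraction \<open>M\<close>, let \<open>\<Phi> M\<close> be the sum of \<open>p i * ln (vol i)\<close> minus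
  \<open>ln \<bar>det M\<bar>\<close>, where \<open>vol i\<close> is the volume of the image under \<open>M\<close> of a fixed basis of \<open>V i\<close>.
  For \<open>p\<close> the indicator of an admissible set \<open>H\<close>, the bases of the \<open>V i\<close> with \<open>i \<in> H\<close> together
  extend to a basis of the whole space, and Hadamard's inequality bounds \<open>\<Phi>\<close> from below; as \<open>\<Phi>\<close>
  is linear in \<open>p\<close>, it is bounded below for every \<open>p\<close> in the convex hull.
  If a unit vector \<open>w\<close> violates the bound for \<open>M\<close>, then composing \<open>M\<close> with the map that
  shrinks the direction \<open>w\<close> by \<open>sqrt (1/2)\<close> lowers \<open>\<Phi>\<close> by at least \<open>(1 - ln 2) / 2\<close>, so some
  \<open>M\<close> has no violation.\<close>

section \<open>Orthogonal projection onto a subspace\<close>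

lemma orth_proj_eqI:
  assumes "subspace S" "y \<in> S" "\<And>v. v \<in> S \<Longrightarrow> (w - y) \<bullet> v = 0"
  shows "orth_proj S w = y"
  unfolding orth_proj_def
  by (rule the1_equality[OF orth_proj_ex1[OF assms(1)]]) (use assms in \<open>auto simp: orthogonal_def\<close>)

lemma inner_diff_orth_proj:
  assumes "subspace S" "v \<in> S"
  shows "(w - orth_proj S w) \<bullet> v = 0"
  using orth_proj_orthogonal[OF assms] by (simp add: orthogonal_def)

lemma orth_proj_inner_self:
  assumes "subspace S"
  shows "w \<bullet> orth_proj S w = (norm (orth_proj S w))\<^sup>2"
  using inner_diff_orth_proj[OF assms orth_proj_in[OF assms], of w w]
  by (simp add: inner_diff_left power2_norm_eq_inner)

lemma norm_diff_orth_proj_le: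
  assumes "subspace S" "y \<in> S"
  shows "norm (w - orth_proj S w) \<le> norm (w - y)"
proof -
  have d: "orth_proj S w - y \<in> S"
    using assms by (simp add: orth_proj_in subspace_diff)
  have "w - y = (w - orth_proj S w) + (orth_proj S w - y)" by simp
  then have "(norm (w - y))\<^sup>2 = (norm (w - orth_proj S w))\<^sup>2 + (norm (orth_proj S w - y))\<^sup>2"
    using norm_add_Pythagorean[of "w - orth_proj S w" "orth_proj S w - y"]
      inner_diff_orth_proj[OF assms(1) d, of w] by (simp add: orthogonal_def)
  then have "(norm (w - orth_proj S w))\<^sup>2 \<le> (norm (w - y))\<^sup>2" by simp
  then show ?thesis by (rule power2_le_imp_le) simp
qed

lemma norm_orth_proj_le:
  assumes "subspace S"
  shows "norm (orth_proj S w) \<le> norm w"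
proof -
  have "(norm (orth_proj S w))\<^sup>2 \<le> norm w * norm (orth_proj S w)"
    using norm_cauchy_schwarz[of w "orth_proj S w"] orth_proj_inner_self[OF assms, of w] by simp
  then show ?thesis
    by (cases "norm (orth_proj S w) = 0") (auto simp: power2_eq_square)
qed

lemma orth_proj_UNIV: "orth_proj UNIV w = w"
  by (rule orth_proj_eqI) auto

text \<open>Since \<open>u\<close> is the part of \<open>v\<close> orthogonal to \<open>S\<close>,
  the enlarged span is the orthogonal sum of \<open>S\<close> and the line through \<open>u\<close>,
  and Pythagoras applies.\<close>

lemma norm_orth_proj_span_insert:
  fixes S :: "'a::euclidean_space set"
  assumes "subspace S" "v \<notin> S"
  defines "u \<equiv> v - orth_proj S v"
  shows "(norm (orth_proj (span (insert v S)) w))\<^sup>2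
    = (norm (orth_proj S w))\<^sup>2 + (w \<bullet> u)\<^sup>2 / (norm u)\<^sup>2"
proof -
  let ?c = "(w \<bullet> u) / (u \<bullet> u)"
  let ?P = "orth_proj S w"
  have u0: "u \<noteq> 0"
    using orth_proj_in[OF assms(1), of v] assms(2) unfolding u_def by auto
  have uS: "u \<bullet> z = 0" if "z \<in> S" for z
    unfolding u_def using inner_diff_orth_proj[OF assms(1) that] .
  have PS: "?P \<in> S" "orth_proj S v \<in> S"
    using assms(1) by (auto intro: orth_proj_in)
  have u_in: "u \<in> span (insert v S)"
    unfolding u_def by (intro span_diff span_base) (use PS in auto)
  have "orth_proj (span (insert v S)) w = ?P + ?c *\<^sub>R u"
  proof (rule orth_proj_eqI)
    show "?P + ?c *\<^sub>R u \<in> span (insert v S)"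
      by (intro span_add span_mul u_in span_base) (use PS in auto)
  next
    fix z assume "z \<in> span (insert v S)"
    then obtain k where k: "z - k *\<^sub>R v \<in> S"
      using span_breakdown_eq[of z v S] assms(1) by (auto simp: span_eq_iff[THEN iffD2])
    define s where "s = (z - k *\<^sub>R v) + k *\<^sub>R orth_proj S v"
    have s: "s \<in> S"
      unfolding s_def by (intro subspace_add subspace_scale) (use k PS assms(1) in auto)
    have z: "z = s + k *\<^sub>R u"
      unfolding s_def u_def by (simp add: algebra_simps)
    have "(w - (?P + ?c *\<^sub>R u)) \<bullet> s = 0"
      using inner_diff_orth_proj[OF assms(1) s, of w] uS[OF s] by (simp add: inner_diff_left inner_add_left)
    moreover have "(w - (?P + ?c *\<^sub>R u)) \<bullet> u = 0"
      using uS[OF PS(1)] u0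
      by (simp add: inner_diff_left inner_add_left inner_commute[of "orth_proj S w" u])
    ultimately show "(w - (?P + ?c *\<^sub>R u)) \<bullet> z = 0"
      unfolding z by (simp add: inner_add_right)
  qed simp
  moreover have "(norm (?P + ?c *\<^sub>R u))\<^sup>2 = (norm ?P)\<^sup>2 + (norm (?c *\<^sub>R u))\<^sup>2"
    using uS[OF PS(1)] by (intro norm_add_Pythagorean) (simp add: orthogonal_def inner_commute)
  moreover have "(norm (?c *\<^sub>R u))\<^sup>2 = (w \<bullet> u)\<^sup>2 / (norm u)\<^sup>2"
    using u0 by (simp add: power_mult_distrib power_divide power2_norm_eq_inner[symmetric] field_simps)
  ultimately show ?thesis by simp
qed

section \<open>Gram volumes and Hadamard-type inequalities\<close>

text \<open>This is the square root of the Gram determinant, as a product of Gram-Schmidt residual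
  lengths. Each vector is reduced modulo the vectors after it, which suits list induction.\<close>

fun gram_vol :: "'a::euclidean_space list \<Rightarrow> real" where
  "gram_vol [] = 1"
| "gram_vol (v # vs) = norm (v - orth_proj (span (set vs)) v) * gram_vol vs"

text \<open>Distinctness is demanded because \<open>set\<close> hides repetitions, which make the
  volume vanish.\<close>

definition lin_indep :: "'a::euclidean_space list \<Rightarrow> bool" where
  "lin_indep vs \<longleftrightarrow> distinct vs \<and> independent (set vs)"

lemma lin_indep_Cons: "lin_indep (v # vs) \<longleftrightarrow> v \<notin> span (set vs) \<and> lin_indep vs"
  unfolding lin_indep_def by (auto simp: independent_insert span_base)

lemma lin_indep_map:
  assumes "lin_indep vs" "linear M" "inj M"
  shows "lin_indep (map M vs)"
  using assms linear_independent_injective_image[of M "set vs"] unfolding lin_indep_def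
  by (auto simp: distinct_map intro: inj_on_subset)

lemma gram_vol_nonneg: "0 \<le> gram_vol vs"
  by (induction vs) auto

lemma gram_vol_pos: "lin_indep vs \<Longrightarrow> 0 < gram_vol vs"
proof (induction vs)
  case (Cons v vs)
  then have "v \<noteq> orth_proj (span (set vs)) v"
    using orth_proj_in[OF subspace_span, of "set vs" v] by (auto simp: lin_indep_Cons)
  with Cons show ?case by (simp add: lin_indep_Cons)
qed simp

text \<open>Putting \<open>ys\<close> behind \<open>xs\<close> enlarges the span modulo which each
  entry of \<open>xs\<close> is reduced, so the residuals can only shrink.\<close>

lemma gram_vol_append_le: "gram_vol (xs @ ys) \<le> gram_vol xs * gram_vol ys"
proof (induction xs)
  case (Cons x xs)
  have "orth_proj (span (set xs)) x \<in> span (set (xs @ ys))"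
    using orth_proj_in[OF subspace_span, of "set xs" x] span_mono[of "set xs" "set (xs @ ys)"] by auto
  then have "norm (x - orth_proj (span (set (xs @ ys))) x) \<le> norm (x - orth_proj (span (set xs)) x)"
    by (intro norm_diff_orth_proj_le) auto
  then show ?case
    using Cons by (auto simp: mult.assoc gram_vol_nonneg intro!: mult_mono)
qed simp

lemma gram_vol_concat_le: "gram_vol (concat xss) \<le> prod_list (map gram_vol xss)"
proof (induction xss)
  case (Cons xs xss)
  have "gram_vol (concat (xs # xss)) \<le> gram_vol xs * gram_vol (concat xss)"
    using gram_vol_append_le by simp
  also have "\<dots> \<le> gram_vol xs * prod_list (map gram_vol xss)"
    using Cons by (intro mult_left_mono gram_vol_nonneg)
  finally show ?case by simp
qed simp

lemma gram_vol_le_prod_norm: "gram_vol vs \<le> prod_list (map norm vs)"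
proof (induction vs)
  case (Cons v vs)
  have "norm (v - orth_proj (span (set vs)) v) \<le> norm v"
    using norm_diff_orth_proj_le[OF subspace_span span_0, of v "set vs"] by simp
  then show ?case
    using Cons by (auto simp: gram_vol_nonneg intro!: mult_mono)
qed simp

section \<open>Squeezing along a unit vector\<close>

definition squeeze :: "'a::euclidean_space \<Rightarrow> 'a \<Rightarrow> 'a" where
  "squeeze w x = x - ((1 - sqrt (1/2)) * (w \<bullet> x)) *\<^sub>R w"

lemma linear_squeeze: "linear (squeeze w)"
  unfolding squeeze_def by (intro linearI) (simp_all add: algebra_simps inner_add_right)

text \<open>With \<open>r = sqrt (1/2)\<close>, the correction along \<open>w\<close> has
  coefficient \<open>1 - r * r = 1/2\<close>. This rank-one formula gives contraction, injectivity
  and the new residual lengths.\<close>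

lemma inner_squeeze:
  assumes "norm w = 1"
  shows "squeeze w x \<bullet> squeeze w y = x \<bullet> y - (w \<bullet> x) * (w \<bullet> y) / 2"
proof -
  define r where "r = sqrt (1/2)"
  have r: "r * r = 1/2" by (simp add: r_def)
  have "w \<bullet> w = 1" using assms by (simp add: norm_eq_1)
  then have "squeeze w x \<bullet> squeeze w y
      = x \<bullet> y - (1 - r) * (w \<bullet> y) * (x \<bullet> w) - ((1 - r) * (w \<bullet> x) * (w \<bullet> y)
        - (1 - r) * (w \<bullet> x) * ((1 - r) * (w \<bullet> y)))"
    unfolding squeeze_def r_def[symmetric]
    by (simp only: inner_diff_left inner_diff_right inner_scaleR_left inner_scaleR_right)
      (simp add: algebra_simps)
  also have "\<dots> = x \<bullet> y - (1 - r * r) * (w \<bullet> x) * (w \<bullet> y)"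
    unfolding inner_commute[of x w] by (simp add: algebra_simps)
  finally show ?thesis unfolding r by simp
qed

lemma norm_squeeze_le:
  assumes "norm w = 1"
  shows "norm (squeeze w x) \<le> norm x"
  unfolding norm_le by (simp add: inner_squeeze[OF assms])

lemma bij_squeeze:
  assumes "norm w = 1"
  shows "bij (squeeze w)"
proof -
  have "x = 0" if "squeeze w x = 0" for x
  proof -
    have "x \<bullet> x = (w \<bullet> x) * (w \<bullet> x) / 2"
      using inner_squeeze[OF assms, of x x] that by simp
    moreover have "(w \<bullet> x) * (w \<bullet> x) \<le> x \<bullet> x"
      using Cauchy_Schwarz_ineq[of w x] assms by (simp add: power2_eq_square norm_eq_1)
    ultimately have "x \<bullet> x \<le> 0" by simp
    then show "x = 0" by (metis inner_ge_zero inner_eq_zero_iff antisym)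
  qed
  then have "inj (squeeze w)"
    using linear_squeeze linear_injective_0 by blast
  then show ?thesis
    using linear_squeeze linear_injective_imp_surjective by (auto simp: bij_def)
qed

text \<open>The orthogonal projection of \<open>squeeze w v\<close> onto \<open>squeeze w ` S\<close> is \<open>squeeze w y\<close> where
  \<open>v - y = u + c P w\<close>, \<open>u\<close> is the part of \<open>v\<close> orthogonal to \<open>S\<close>, \<open>P\<close> is the projection
  onto \<open>S\<close>, and \<open>c\<close> solves \<open>2 c = w \<bullet> u + c (norm (P w))\<^sup>2\<close>.\<close>

lemma norm_squeeze_diff_orth_proj:
  fixes S :: "'a::euclidean_space set"
  assumes w: "norm w = 1" and S: "subspace S" and v: "v \<notin> S"
  shows "(norm (squeeze w v - orth_proj (squeeze w ` S) (squeeze w v)))\<^sup>2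
      * (1 - (norm (orth_proj S w))\<^sup>2 / 2)
    = (norm (v - orth_proj S v))\<^sup>2 * (1 - (norm (orth_proj (span (insert v S)) w))\<^sup>2 / 2)"
proof -
  define u where "u = v - orth_proj S v"
  define a where "a = w \<bullet> u"
  define P where "P = orth_proj S w"
  define r where "r = (norm P)\<^sup>2"
  define c where "c = a / (2 - r)"
  define y where "y = orth_proj S v - c *\<^sub>R P"
  have "norm P \<le> 1" using norm_orth_proj_le[OF S, of w] w by (simp add: P_def)
  then have r1: "r \<le> 1" by (simp add: r_def power_le_one)
  have c: "2 * c = a + c * r" using r1 by (simp add: c_def field_simps)
  have PS: "P \<in> S" and vS: "orth_proj S v \<in> S"
    unfolding P_def using S by (auto intro: orth_proj_in)
  have yS: "y \<in> S"
    unfolding y_def by (intro subspace_diff subspace_scale PS vS S)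
  have vy: "v - y = u + c *\<^sub>R P" by (simp add: y_def u_def)
  have uS: "u \<bullet> z = 0" if "z \<in> S" for z
    unfolding u_def using inner_diff_orth_proj[OF S that] .
  have Pz: "P \<bullet> z = w \<bullet> z" if "z \<in> S" for z
    unfolding P_def using inner_diff_orth_proj[OF S that, of w] by (simp add: inner_diff_left)
  have wP: "w \<bullet> P = r" "P \<bullet> P = r"
    using orth_proj_inner_self[OF S, of w] by (auto simp: P_def r_def power2_norm_eq_inner)
  have u0: "u \<noteq> 0" using v vS unfolding u_def by auto
  \<comment> \<open>The choice of \<open>c\<close> serves this equation: in
    \<open>inner_squeeze\<close>, half of \<open>2 * c * (w \<bullet> z)\<close> then cancels
    \<open>(v - y) \<bullet> z\<close> for all \<open>z\<close> in \<open>S\<close>.\<close>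
  have wvy: "w \<bullet> (v - y) = 2 * c"
    unfolding vy using c by (simp add: inner_add_right wP a_def)
  have D: "squeeze w v - squeeze w y = squeeze w (v - y)"
    using linear_squeeze linear_diff by metis
  have "orth_proj (squeeze w ` S) (squeeze w v) = squeeze w y"
  proof (rule orth_proj_eqI)
    show "subspace (squeeze w ` S)" using linear_squeeze S by (rule linear_subspace_image)
    show "squeeze w y \<in> squeeze w ` S" using yS by simp
    fix x assume "x \<in> squeeze w ` S"
    then obtain z where z: "z \<in> S" "x = squeeze w z" by auto
    have "(v - y) \<bullet> z = c * (w \<bullet> z)"
      unfolding vy by (simp add: inner_add_left uS Pz z)
    then show "(squeeze w v - squeeze w y) \<bullet> x = 0"
      unfolding D z inner_squeeze[OF w] wvy by simp
  qed
  then have "(norm (squeeze w v - orth_proj (squeeze w ` S) (squeeze w v)))\<^sup>2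
      = (v - y) \<bullet> (v - y) - 2 * c * c"
    using inner_squeeze[OF w, of "v - y" "v - y"] wvy D by (simp add: power2_norm_eq_inner)
  moreover have "(v - y) \<bullet> (v - y) = u \<bullet> u + c * c * r"
    unfolding vy using uS[OF PS]
    by (simp add: inner_add_left inner_add_right inner_commute[of P u] wP)
  moreover have "2 * c * c = c * a + c * c * r"
    using arg_cong[OF c, of "\<lambda>z. c * z"] by (simp add: algebra_simps)
  ultimately have 1: "(norm (squeeze w v - orth_proj (squeeze w ` S) (squeeze w v)))\<^sup>2
      = u \<bullet> u - c * a"
    by simp
  have 2: "(norm (orth_proj (span (insert v S)) w))\<^sup>2 = r + a\<^sup>2 / (u \<bullet> u)"
    using norm_orth_proj_span_insert[OF S v, of w]
    unfolding u_def[symmetric] a_def[symmetric] P_def[symmetric] r_def[symmetric]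
    by (simp add: power2_norm_eq_inner)
  \<comment> \<open>Both sides equal
    \<open>(u \<bullet> u) * (1 - r / 2) - a\<^sup>2 / 2\<close>.\<close>
  have "(u \<bullet> u - c * a) * (1 - r / 2) = u \<bullet> u * (1 - (r + a\<^sup>2 / (u \<bullet> u)) / 2)"
    using u0 r1 by (simp add: c_def field_simps power2_eq_square)
  then show ?thesis
    unfolding 1 2 u_def[symmetric] P_def[symmetric] r_def[symmetric]
    by (simp add: power2_norm_eq_inner)
qed

lemma half_le_squeeze_factor:
  assumes "norm w = 1" "subspace S"
  shows "1/2 \<le> 1 - (norm (orth_proj S w))\<^sup>2 / 2"
proof -
  have "(norm (orth_proj S w))\<^sup>2 \<le> 1"
    using norm_orth_proj_le[OF assms(2), of w] assms(1) by (simp add: power_le_one)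
  then show ?thesis by simp
qed

text \<open>Each squared residual is multiplied by the quotient of the factors
  \<open>1 - (norm (P w))\<^sup>2 / 2\<close> of two successive spans, so the product telescopes,
  starting from factor 1 for the zero space.\<close>

lemma gram_vol_squeeze:
  fixes vs :: "'a::euclidean_space list"
  assumes "norm w = 1" "lin_indep vs"
  shows "(gram_vol (map (squeeze w) vs))\<^sup>2
    = (1 - (norm (orth_proj (span (set vs)) w))\<^sup>2 / 2) * (gram_vol vs)\<^sup>2"
  using assms(2)
proof (induction vs)
  case Nil
  have "orth_proj {0} w = 0" by (rule orth_proj_eqI) auto
  then show ?case by simp
next
  case (Cons v vs)
  let ?S = "span (set vs)"
  have v: "v \<notin> ?S" and vs: "lin_indep vs" using Cons.prems by (auto simp: lin_indep_Cons)
  have im: "span (squeeze w ` set vs) = squeeze w ` ?S"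
    using linear_span_image[OF linear_squeeze] .
  have ins: "span (insert v ?S) = span (set (v # vs))"
    by (simp add: span_insert span_span)
  have "(gram_vol (map (squeeze w) (v # vs)))\<^sup>2
    = (norm (squeeze w v - orth_proj (squeeze w ` ?S) (squeeze w v)))\<^sup>2
      * (1 - (norm (orth_proj ?S w))\<^sup>2 / 2) * (gram_vol vs)\<^sup>2"
    using Cons.IH[OF vs] by (simp add: im power_mult_distrib)
  also have "\<dots> = (norm (v - orth_proj ?S v))\<^sup>2
      * (1 - (norm (orth_proj (span (set (v # vs))) w))\<^sup>2 / 2) * (gram_vol vs)\<^sup>2"
    using norm_squeeze_diff_orth_proj[OF assms(1) subspace_span v] by (simp add: ins)
  finally show ?case by (simp add: power_mult_distrib mult_ac)
qed

section \<open>Contractions with a volume factor\<close>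

text \<open>Here \<open>J\<close> plays the role of the absolute value of the determinant of \<open>M\<close>.\<close>

definition contraction_with_vol :: "('a::euclidean_space \<Rightarrow> 'a) \<Rightarrow> real \<Rightarrow> bool" where
  "contraction_with_vol M J \<longleftrightarrow> linear M \<and> bij M \<and> (\<forall>x. norm (M x) \<le> norm x) \<and> 0 < J \<and>
    (\<forall>vs. lin_indep vs \<and> span (set vs) = UNIV \<longrightarrow> gram_vol (map M vs) = J * gram_vol vs)"

lemma contraction_with_vol_id: "contraction_with_vol id 1"
  unfolding contraction_with_vol_def by (auto simp: linear_id)

lemma contraction_with_vol_squeeze:
  assumes M: "contraction_with_vol M J" and w: "norm w = 1"
  shows "contraction_with_vol (squeeze w \<circ> M) (sqrt (1/2) * J)"
proof -
  have lin: "linear M" and bij: "bij M" and J: "0 < J" and le: "\<And>x. norm (M x) \<le> norm x"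
    using M by (auto simp: contraction_with_vol_def)
  have "gram_vol (map (squeeze w \<circ> M) vs) = sqrt (1/2) * J * gram_vol vs"
    if vs: "lin_indep vs" "span (set vs) = UNIV" for vs
  proof -
    have "lin_indep (map M vs)" using vs lin bij by (auto intro: lin_indep_map bij_is_inj)
    moreover have "span (set (map M vs)) = UNIV"
      using linear_span_image[OF lin, of "set vs"] vs bij by (simp add: bij_is_surj)
    \<comment> \<open>On a spanning list \<open>w\<close> is its own projection, so the factor is
      \<open>1 - 1/2\<close>, the squared determinant of \<open>squeeze w\<close>.\<close>
    ultimately have "(gram_vol (map (squeeze w) (map M vs)))\<^sup>2 = 1/2 * (gram_vol (map M vs))\<^sup>2"
      using gram_vol_squeeze[OF w, of "map M vs"] w by (simp add: orth_proj_UNIV)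
    also have "\<dots> = (sqrt (1/2) * J * gram_vol vs)\<^sup>2"
      using M vs by (simp add: contraction_with_vol_def power_mult_distrib real_sqrt_divide power_divide)
    finally show ?thesis
      using J by (subst (asm) power2_eq_iff_nonneg) (auto simp: gram_vol_nonneg)
  qed
  moreover have "norm ((squeeze w \<circ> M) x) \<le> norm x" for x
    using norm_squeeze_le[OF w, of "M x"] le[of x] by simp
  moreover have "bij (squeeze w \<circ> M)" using bij bij_squeeze[OF w] by (rule bij_comp)
  moreover have "linear (squeeze w \<circ> M)" using lin linear_squeeze by (rule linear_compose)
  ultimately show ?thesis
    using J unfolding contraction_with_vol_def by simp
qed

section \<open>Lower bound for the potential\<close>

lemma set_sum_subset_span:
  assumes "finite H" "\<And>i. i \<in> H \<Longrightarrow> V i \<subseteq> span B"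
  shows "(\<Sum>i\<in>H. V i) \<subseteq> span (B :: 'a::euclidean_space set)"
  using assms
proof (induction H)
  case (insert i H)
  then show ?case
    by (auto simp: set_plus_def intro!: span_add)
qed (auto simp: set_zero span_0)

text \<open>By admissibility the total length of the bases is the dimension of the sum, which lies
  in the span of their entries. A list no longer than the dimension it spans can have neither
  repetitions nor dependences.\<close>

lemma admissible_lin_indep_concat:
  fixes b :: "'n \<Rightarrow> 'a::euclidean_space list"
  assumes adm: "admissible_set V (set hs)" and "distinct hs"
    and b: "\<And>i. lin_indep (b i)" "\<And>i. span (set (b i)) = V i"
  shows "lin_indep (concat (map b hs))"
proof -
  let ?B = "set (concat (map b hs))"
  have dim: "dim (V i) = length (b i)" for i
    using b[of i] dim_span_eq_card_independent[of "set (b i)"]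
    by (simp add: lin_indep_def distinct_card)
  have "(\<Sum>i\<in>set hs. V i) \<subseteq> span ?B"
  proof (rule set_sum_subset_span)
    fix i assume "i \<in> set hs"
    then have "set (b i) \<subseteq> ?B" by auto
    then show "V i \<subseteq> span ?B" using span_mono b(2) by blast
  qed simp
  then have "dim (\<Sum>i\<in>set hs. V i) \<le> dim ?B"
    by (metis dim_span dim_subset)
  then have 1: "(\<Sum>i\<in>set hs. length (b i)) \<le> dim ?B"
    using adm by (simp add: admissible_set_def dim)
  have "(\<Sum>i\<in>set hs. length (b i)) = length (concat (map b hs))"
    using \<open>distinct hs\<close> by (simp add: length_concat sum_list_distinct_conv_sum_set comp_def)
  with 1 have 2: "length (concat (map b hs)) \<le> dim ?B" by simp
  have 3: "dim ?B \<le> card ?B" by (rule dim_le_card') simp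
  have 4: "card ?B \<le> length (concat (map b hs))" by (rule card_length)
  have "card ?B = length (concat (map b hs))" using 2 3 4 by linarith
  then have "distinct (concat (map b hs))" by (rule card_distinct)
  moreover have "independent ?B"
    by (rule card_le_dim_spanning[of _ "span ?B"]) (use 2 4 in \<open>auto simp del: set_concat intro: span_base\<close>)
  ultimately show ?thesis by (simp add: lin_indep_def)
qed

text \<open>The volume of the image of a full basis is exactly \<open>J\<close> times a constant and
  at most the product of the volumes of its blocks. The constant \<open>C\<close> must serve all
  \<open>M\<close> and \<open>J\<close> at once.\<close>

lemma potential_bound_admissible:
  fixes b :: "'n \<Rightarrow> 'a::euclidean_space list"
  assumes adm: "admissible_set V H" and "finite H"
    and b: "\<And>i. lin_indep (b i)" "\<And>i. span (set (b i)) = V i"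
  shows "\<exists>C. \<forall>M J. contraction_with_vol M J \<longrightarrow>
    ln J + C \<le> (\<Sum>i\<in>H. ln (gram_vol (map M (b i))))"
proof -
  obtain hs where hs: "set hs = H" "distinct hs"
    using finite_distinct_list[OF \<open>finite H\<close>] by blast
  let ?bs = "concat (map b hs)"
  have ind: "lin_indep ?bs"
    using admissible_lin_indep_concat[of V hs b] adm b hs by auto
  then obtain B where B: "set ?bs \<subseteq> B" "independent B" "UNIV \<subseteq> span B"
    unfolding lin_indep_def by (metis maximal_independent_subset_extend subset_UNIV)
  have "finite B" using B(2) by (rule independent_imp_finite)
  then obtain cs where cs: "set cs = B - set ?bs" "distinct cs"
    using finite_distinct_list[of "B - set ?bs"] by blast
  let ?vs = "cs @ ?bs"
  have setvs: "set ?vs = B" using cs(1) B(1) by auto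
  have vs: "lin_indep ?vs" "span (set ?vs) = UNIV"
    unfolding setvs lin_indep_def using ind B cs by (auto simp: lin_indep_def simp del: set_concat)
  have gv: "0 < gram_vol ?vs" by (rule gram_vol_pos[OF vs(1)])
  \<comment> \<open>Contractions do not lengthen the added vectors \<open>cs\<close>, so
    \<open>K\<close> bounds the volume of their image independently of \<open>M\<close>.\<close>
  define K where "K = prod_list (map norm cs)"
  have nz: "\<forall>c\<in>set cs. c \<noteq> 0" using cs B(2) dependent_zero by blast
  have K: "0 < K"
    unfolding K_def using nz by (induction cs) auto
  have "ln J + (ln (gram_vol ?vs) - ln K) \<le> (\<Sum>i\<in>H. ln (gram_vol (map M (b i))))"
    if M: "contraction_with_vol M J" for M J
  proof -
    have lin: "linear M" and inj: "inj M" and J: "0 < J" and le: "\<And>x. norm (M x) \<le> norm x"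
      using M by (auto simp: contraction_with_vol_def bij_is_inj)
    have pos: "0 < gram_vol (map M (b i))" for i
      by (intro gram_vol_pos lin_indep_map b lin inj)
    let ?Q = "\<Prod>i\<in>H. gram_vol (map M (b i))"
    have Q: "0 < ?Q" by (rule prod_pos) (simp add: pos)
    have "J * gram_vol ?vs = gram_vol (map M ?vs)"
      using M vs unfolding contraction_with_vol_def by metis
    also have "\<dots> \<le> gram_vol (map M cs) * gram_vol (map M ?bs)"
      using gram_vol_append_le by simp
    also have "\<dots> \<le> K * ?Q"
    proof (intro mult_mono)
      have "gram_vol (map M cs) \<le> prod_list (map norm (map M cs))"
        by (rule gram_vol_le_prod_norm)
      also have "\<dots> \<le> prod_list (map norm cs)"
        by (induction cs) (auto intro!: mult_mono le prod_list_nonneg)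
      finally show "gram_vol (map M cs) \<le> K" unfolding K_def .
      have "gram_vol (map M ?bs) = gram_vol (concat (map (\<lambda>i. map M (b i)) hs))"
        by (simp add: map_concat comp_def)
      also have "\<dots> \<le> prod_list (map gram_vol (map (\<lambda>i. map M (b i)) hs))"
        by (rule gram_vol_concat_le)
      also have "\<dots> = ?Q"
        using hs prod.distinct_set_conv_list[of hs "\<lambda>i. gram_vol (map M (b i))"] by (simp add: comp_def)
      finally show "gram_vol (map M ?bs) \<le> ?Q" .
    qed (use K in \<open>auto simp: gram_vol_nonneg\<close>)
    finally have "ln (J * gram_vol ?vs) \<le> ln (K * ?Q)"
      using J gv by (intro ln_mono) auto
    then have "ln J + ln (gram_vol ?vs) \<le> ln K + ln ?Q"
      using J gv K Q by (simp add: ln_mult)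
    moreover have "ln ?Q = (\<Sum>i\<in>H. ln (gram_vol (map M (b i))))"
      by (rule ln_prod) (simp_all add: pos order.strict_implies_not_eq[OF pos, symmetric] \<open>finite H\<close>)
    ultimately show ?thesis by simp
  qed
  then show ?thesis by blast
qed

lemma inner_indicator_vec: "indicator_vec H \<bullet> x = (\<Sum>i\<in>H. x $ i)"
  unfolding indicator_vec_def inner_vec_def
  by (auto simp: indicator_def intro!: sum.mono_neutral_cong_right)

text \<open>For fixed \<open>M\<close> and \<open>J\<close> the bound describes a half-space in
  \<open>p\<close>; containing every admissible vector, it contains their hull.\<close>

lemma potential_bound:
  fixes b :: "'n::finite \<Rightarrow> 'a::euclidean_space list"
  assumes p: "p \<in> convex hull (admissible_vectors V)"
    and b: "\<And>i. lin_indep (b i)" "\<And>i. span (set (b i)) = V i"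
  shows "\<exists>C. \<forall>M J. contraction_with_vol M J \<longrightarrow>
    ln J + C \<le> (\<Sum>i\<in>UNIV. p $ i * ln (gram_vol (map M (b i))))"
proof -
  have "\<forall>H. \<exists>C. admissible_set V H \<longrightarrow> (\<forall>M J. contraction_with_vol M J \<longrightarrow>
      ln J + C \<le> (\<Sum>i\<in>H. ln (gram_vol (map M (b i)))))"
    using potential_bound_admissible[where b = b and V = V] b by (metis finite)
  then obtain C where C: "\<And>H M J. admissible_set V H \<Longrightarrow> contraction_with_vol M J \<Longrightarrow>
      ln J + C H \<le> (\<Sum>i\<in>H. ln (gram_vol (map M (b i))))"
    by metis
  \<comment> \<open>There are finitely many sets \<open>H\<close>. The arbitrary values of
    \<open>C\<close> at non-admissible sets can only lower the minimum.\<close>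
  have "ln J + Min (range C) \<le> (\<Sum>i\<in>UNIV. p $ i * ln (gram_vol (map M (b i))))"
    if M: "contraction_with_vol M J" for M J
  proof -
    define x where "x = (\<chi> i. ln (gram_vol (map M (b i))))"
    have "admissible_vectors V \<subseteq> {q. x \<bullet> q \<ge> ln J + Min (range C)}"
    proof
      fix q assume "q \<in> admissible_vectors V"
      then obtain H where H: "q = indicator_vec H" "admissible_set V H"
        by (auto simp: admissible_vectors_def)
      have "Min (range C) \<le> C H" by (rule Min_le) auto
      then have "ln J + Min (range C) \<le> ln J + C H" by (rule add_left_mono)
      also have "\<dots> \<le> indicator_vec H \<bullet> x"
        unfolding inner_indicator_vec x_def using C[OF H(2) M] by simp
      finally have "ln J + Min (range C) \<le> indicator_vec H \<bullet> x" .
      then show "q \<in> {q. x \<bullet> q \<ge> ln J + Min (range C)}"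
        by (simp add: H inner_commute)
    qed
    then have "convex hull (admissible_vectors V) \<subseteq> {q. x \<bullet> q \<ge> ln J + Min (range C)}"
      by (rule hull_minimal) (rule convex_halfspace_ge)
    then show ?thesis
      using p by (auto simp: inner_vec_def x_def mult.commute)
  qed
  then show ?thesis by blast
qed

section \<open>Decrease of the potential and conclusion\<close>

lemma admissible_hull_nonneg:
  assumes "p \<in> convex hull (admissible_vectors V)"
  shows "0 \<le> p $ i"
proof -
  have "convex hull (admissible_vectors V) \<subseteq> {q. axis i 1 \<bullet> q \<ge> 0}"
  proof (rule hull_minimal)
    show "admissible_vectors V \<subseteq> {q. axis i 1 \<bullet> q \<ge> 0}"
      by (auto simp: admissible_vectors_def indicator_vec_def inner_axis')
  qed (rule convex_halfspace_ge)
  then show ?thesis using assms by (auto simp: inner_axis')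
qed

text \<open>The constant 2 is what makes \<open>squeeze\<close> lower the potential by a fixed amount: it gains
  \<open>ln 2 / 2\<close> from the volume of \<open>M\<close> but loses at least 1/2 from the subspaces,
  since \<open>ln (1 - t/2) \<le> - t/2\<close>.\<close>

lemma potential_squeeze:
  fixes b :: "'n::finite \<Rightarrow> 'a::euclidean_space list"
  assumes b: "\<And>i. lin_indep (b i)" "\<And>i. span (set (b i)) = V i"
    and p: "\<And>i. 0 \<le> p i"
    and M: "contraction_with_vol M J" and w: "norm w = 1"
    and gt: "2 < (\<Sum>i\<in>UNIV. p i * (norm (orth_proj (M ` V i) w))\<^sup>2)"
  shows "(\<Sum>i\<in>UNIV. p i * ln (gram_vol (map (squeeze w \<circ> M) (b i)))) - ln (sqrt (1/2) * J)
    \<le> (\<Sum>i\<in>UNIV. p i * ln (gram_vol (map M (b i)))) - ln J - (1 - ln 2) / 2"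
proof -
  have lin: "linear M" and inj: "inj M" and J: "0 < J"
    using M by (auto simp: contraction_with_vol_def bij_is_inj)
  let ?g = "\<lambda>i. gram_vol (map M (b i))" and ?g' = "\<lambda>i. gram_vol (map (squeeze w \<circ> M) (b i))"
  let ?t = "\<lambda>i. (norm (orth_proj (M ` V i) w))\<^sup>2"
  \<comment> \<open>The factor \<open>1 - ?t i / 2\<close> acts on the squared volume; taking the
    logarithm of the volume itself turns \<open>?t i / 2\<close> into
    \<open>?t i / 4\<close>.\<close>
  have step: "ln (?g' i) \<le> ln (?g i) - ?t i / 4" for i
  proof -
    have ind: "lin_indep (map M (b i))" by (intro lin_indep_map b lin inj)
    then have "lin_indep (map (squeeze w) (map M (b i)))"
      using linear_squeeze bij_is_inj[OF bij_squeeze[OF w]] by (rule lin_indep_map)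
    then have pos: "0 < ?g i" "0 < ?g' i" using ind gram_vol_pos by fastforce+
    have sp: "span (set (map M (b i))) = M ` V i"
      using linear_span_image[OF lin, of "set (b i)"] b(2) by simp
    have f: "0 < 1 - ?t i / 2"
      using half_le_squeeze_factor[OF w subspace_span, of "set (map M (b i))"] unfolding sp by simp
    have "(?g' i)\<^sup>2 = (1 - ?t i / 2) * (?g i)\<^sup>2"
      using gram_vol_squeeze[OF w ind] unfolding sp by simp
    then have "ln ((?g' i)\<^sup>2) = ln (1 - ?t i / 2) + ln ((?g i)\<^sup>2)"
      using f pos by (simp add: ln_mult)
    then have "2 * ln (?g' i) = ln (1 - ?t i / 2) + 2 * ln (?g i)"
      using pos by (simp add: ln_realpow)
    moreover have "ln (1 - ?t i / 2) \<le> - ?t i / 2"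
      using ln_le_minus_one[OF f] by simp
    ultimately show ?thesis by simp
  qed
  have "(\<Sum>i\<in>UNIV. p i * ln (?g' i)) \<le> (\<Sum>i\<in>UNIV. p i * (ln (?g i) - ?t i / 4))"
    by (intro sum_mono mult_left_mono step p)
  also have "\<dots> = (\<Sum>i\<in>UNIV. p i * ln (?g i)) - (\<Sum>i\<in>UNIV. p i * ?t i) / 4"
    by (simp add: right_diff_distrib sum_subtractf sum_divide_distrib)
  finally have "(\<Sum>i\<in>UNIV. p i * ln (?g' i)) \<le> (\<Sum>i\<in>UNIV. p i * ln (?g i)) - 1/2"
    using gt by linarith
  \<comment> \<open>Subtracting the new logarithm gives back \<open>ln 2 / 2\<close>, so the net
    change is at most \<open>- 1/2 + ln 2 / 2\<close>.\<close>
  moreover have "ln (sqrt (1/2) * J) = ln J - ln 2 / 2"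
    using J by (simp add: ln_mult ln_sqrt ln_div)
  ultimately show ?thesis by (simp add: field_simps)
qed

theorem theorem22:
  fixes V :: "'n::finite \<Rightarrow> (real ^ 'l) set" and p :: "real ^ 'n"
  assumes "\<And>i. subspace (V i)"
    and "p \<in> convex hull (admissible_vectors V)"
  shows "\<exists>M :: real ^ 'l \<Rightarrow> real ^ 'l. linear M \<and> bij M \<and>
    (\<forall>w. norm w = 1 \<longrightarrow> (\<Sum>i\<in>UNIV. p $ i * (norm (orth_proj (M ` V i) w))\<^sup>2) \<le> 2)"
proof (rule ccontr)
  assume neg: "\<not> ?thesis"
  have "\<exists>bs. lin_indep bs \<and> span (set bs) = V i" for i
  proof -
    obtain B where B: "B \<subseteq> V i" "independent B" "V i \<subseteq> span B"
      by (rule basis_exists)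
    obtain bs where "set bs = B" "distinct bs"
      using finite_distinct_list[OF independent_imp_finite[OF B(2)]] by blast
    moreover have "span B = V i"
      using B assms(1) by (intro antisym span_minimal)
    ultimately show ?thesis using B(2) by (auto simp: lin_indep_def)
  qed
  then obtain b where b: "\<And>i. lin_indep (b i)" "\<And>i. span (set (b i)) = V i"
    by metis
  define \<Phi> where "\<Phi> M J = (\<Sum>i\<in>UNIV. p $ i * ln (gram_vol (map M (b i)))) - ln J"
    for M :: "real ^ 'l \<Rightarrow> real ^ 'l" and J
  obtain C where C: "\<forall>M J. contraction_with_vol M J \<longrightarrow>
      ln J + C \<le> (\<Sum>i\<in>UNIV. p $ i * ln (gram_vol (map M (b i))))"
    using potential_bound[OF assms(2) b] by (rule exE)
  \<comment> \<open>Under the negated claim every \<open>M\<close> has a violating \<open>w\<close>,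
    so squeezing can be repeated without end.\<close>
  have iter: "\<exists>M J. contraction_with_vol M J \<and> \<Phi> M J \<le> \<Phi> id 1 - real k * ((1 - ln 2) / 2)" for k
  proof (induction k)
    case 0
    show ?case by (intro exI[of _ id] exI[of _ 1] conjI contraction_with_vol_id) simp
  next
    case (Suc k)
    then obtain M J where M: "contraction_with_vol M J"
      and k: "\<Phi> M J \<le> \<Phi> id 1 - real k * ((1 - ln 2) / 2)" by blast
    obtain w where w: "norm w = 1" "2 < (\<Sum>i\<in>UNIV. p $ i * (norm (orth_proj (M ` V i) w))\<^sup>2)"
    proof -
      have "linear M" "bij M" using M by (simp_all add: contraction_with_vol_def)
      then have "\<not> (\<forall>w. norm w = 1 \<longrightarrow> (\<Sum>i\<in>UNIV. p $ i * (norm (orth_proj (M ` V i) w))\<^sup>2) \<le> 2)"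
        using neg by blast
      then show ?thesis using that by (auto simp: not_le)
    qed
    have "\<Phi> (squeeze w \<circ> M) (sqrt (1/2) * J) \<le> \<Phi> M J - (1 - ln 2) / 2"
      unfolding \<Phi>_def
      by (rule potential_squeeze[OF b admissible_hull_nonneg[OF assms(2)] M w])
    also have "\<dots> \<le> \<Phi> id 1 - real (Suc k) * ((1 - ln 2) / 2)"
      unfolding of_nat_Suc distrib_right using k by linarith
    finally have le: "\<Phi> (squeeze w \<circ> M) (sqrt (1/2) * J)
        \<le> \<Phi> id 1 - real (Suc k) * ((1 - ln 2) / 2)" .
    show ?case
      by (intro exI conjI) (rule contraction_with_vol_squeeze[OF M w(1)], rule le)
  qed
  have le: "real k * ((1 - ln 2) / 2) \<le> \<Phi> id 1 - C" for k
  proof -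
    obtain M J where M: "contraction_with_vol M J"
      and k: "\<Phi> M J \<le> \<Phi> id 1 - real k * ((1 - ln 2) / 2)"
      using iter[of k] by blast
    have "C \<le> \<Phi> M J"
      using C[rule_format, OF M] unfolding \<Phi>_def by linarith
    with k show ?thesis by linarith
  qed
  \<comment> \<open>A positive decrement per step, repeated often enough, contradicts the lower
    bound \<open>C\<close>.\<close>
  have "0 < (1 - ln 2) / (2::real)"
    using ln_2_less_1 by simp
  from reals_Archimedean3[OF this] obtain k where "\<Phi> id 1 - C < real k * ((1 - ln 2) / 2)"
    by (elim allE exE)
  with le[of k] show False by linarith
qed

end
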